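(* $$\sup_{x\in(0,\frac{1}{\beta-1})}\left\{\limsup_{k\to\infty}\frac{\log_2\mathcal{N}_k(x,\beta)}{k}\right\}\to 0\quad\text{as }\beta\to2,$$ where the limit is taken over $\beta\in(1,2)$.
   Context: For $1<\beta<2$, $x\in[0,\frac{1}{\beta-1}]$ and $k\in\mathbb{N}$, let $\mathcal{E}_k(x,\beta)$ be the set of $(\epsilon_1,\ldots,\epsilon_k)\in\{0,1\}^k$ for which there exists $(\epsilon_{k+1},\epsilon_{k+2},\ldots)\in\{0,1\}^{\mathbb{N}}$ with $\sum_{n=1}^{\infty}\epsilon_n\beta^{-n}=x$, and let $\mathcal{N}_k(x,\beta)=\#\mathcal{E}_k(x,\beta)$. *)

theory Defs
  imports "HOL-Analysis.Analysis"
begin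

text \<open>
  Digit sequences are indexed from 0: \<open>e n\<close> is the digit written $\epsilon_{n+1}$ on paper,
  hence the weight \<open>\<beta> ^ Suc n\<close>. A finite word in $\{0,1\}^k$ is a list of length \<open>k\<close>.
\<close>

definition is_expansion :: "real \<Rightarrow> real \<Rightarrow> (nat \<Rightarrow> nat) \<Rightarrow> bool" where
  "is_expansion x \<beta> e \<longleftrightarrow>
     (\<forall>n. e n \<in> {0, 1}) \<and> (\<lambda>n. real (e n) / \<beta> ^ Suc n) sums x"

definition expansion_prefixes :: "nat \<Rightarrow> real \<Rightarrow> real \<Rightarrow> nat list set" where
  "expansion_prefixes k x \<beta> =
     {w. length w = k \<and> set w \<subseteq> {0, 1} \<and>
         (\<exists>e. is_expansion x \<beta> e \<and> (\<forall>n<k. e n = w ! n))}"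

definition num_prefixes :: "nat \<Rightarrow> real \<Rightarrow> real \<Rightarrow> nat" where
  "num_prefixes k x \<beta> = card (expansion_prefixes k x \<beta>)"

text \<open>
  The limit superior is taken in \<^typ>\<open>ereal\<close>, where it and the supremum over \<open>x\<close> always exist.
\<close>

definition growth_rate :: "real \<Rightarrow> real \<Rightarrow> ereal" where
  "growth_rate x \<beta> = limsup (\<lambda>k. ereal (log 2 (real (num_prefixes k x \<beta>)) / real k))"

end

theory Submission
  imports Defs
begin

text \<open>
  If a word \<open>w\<close> of length \<open>m\<close> begins an expansion of \<open>x\<close>, then the value of \<open>w\<close> lies within
  $\beta^{-m}/(\beta-1)$ below \<open>x\<close>, because the remaining digits contribute at most a geometric
  tail.  In base \<open>2\<close> this window has length $2^{-m}$, while the values of the words of length \<open>m\<close>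
  are distinct multiples of $2^{-m}$, so the window contains at most two of them.  For fixed \<open>m\<close>
  only finitely many words are involved and everything depends continuously on $\beta$; hence for
  all $\beta$ sufficiently close to \<open>2\<close>, and simultaneously for all \<open>x\<close>, there are still at most two
  prefixes of length \<open>m\<close> (lemma \<open>eventually_num_prefixes_le_2\<close>).

  Deleting an initial block of \<open>m\<close> digits turns an expansion of \<open>x\<close> into an expansion of another
  number, so this uniform bound can be iterated: the maximum over all \<open>x\<close> of the number of
  prefixes at most doubles whenever the length grows by \<open>m\<close> (lemma \<open>num_prefixes_le_power\<close>).
  Therefore the growth rate is at most $1/m$, uniformly in \<open>x\<close>, and \<open>m\<close> was arbitrary.
\<close>

definition word_value :: "real \<Rightarrow> nat list \<Rightarrow> real" where
  "word_value \<beta> w = (\<Sum>n<length w. real (w ! n) / \<beta> ^ Suc n)"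

definition binary_words :: "nat \<Rightarrow> nat list set" where
  "binary_words k = {w. set w \<subseteq> {0, 1} \<and> length w = k}"

lemma finite_binary_words: "finite (binary_words k)"
  unfolding binary_words_def by (intro finite_lists_length_eq) simp

lemma card_binary_words: "card (binary_words k) = 2 ^ k"
proof -
  have "card (binary_words k) = card {0, 1 :: nat} ^ k"
    unfolding binary_words_def by (intro card_lists_length_eq) simp
  thus ?thesis by (simp add: numeral_2_eq_2)
qed

lemma expansion_prefixes_subset: "expansion_prefixes k x \<beta> \<subseteq> binary_words k"
  unfolding expansion_prefixes_def binary_words_def by auto

lemma finite_expansion_prefixes: "finite (expansion_prefixes k x \<beta>)"
  using finite_subset[OF expansion_prefixes_subset finite_binary_words] .

section \<open>Words in base two\<close>

fun binary_number :: "nat list \<Rightarrow> nat" where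
  "binary_number [] = 0"
| "binary_number (a # w) = a * 2 ^ length w + binary_number w"

lemma binary_number_less: "set w \<subseteq> {0, 1} \<Longrightarrow> binary_number w < 2 ^ length w"
  by (induction w) auto

lemma inj_on_binary_number: "inj_on binary_number (binary_words k)"
proof (induction k)
  case 0
  show ?case by (auto simp: binary_words_def inj_on_def)
next
  case (Suc k)
  show ?case
  proof (rule inj_onI)
    fix u v
    assume u: "u \<in> binary_words (Suc k)" and v: "v \<in> binary_words (Suc k)"
      and eq: "binary_number u = binary_number v"
    obtain a u' where u': "u = a # u'" "a \<in> {0, 1}" "u' \<in> binary_words k"
      using u by (cases u) (auto simp: binary_words_def)
    obtain b v' where v': "v = b # v'" "b \<in> {0, 1}" "v' \<in> binary_words k"
      using v by (cases v) (auto simp: binary_words_def)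
    have "binary_number u' < 2 ^ k" "binary_number v' < 2 ^ k"
      using binary_number_less[of u'] binary_number_less[of v'] u' v'
      by (auto simp: binary_words_def)
    moreover have "length u' = k" "length v' = k"
      using u' v' by (auto simp: binary_words_def)
    ultimately have "a = b \<and> binary_number u' = binary_number v'"
      using eq u' v' by auto
    thus "u = v"
      using Suc.IH u' v' by (auto dest: inj_onD)
  qed
qed

lemma word_value_2: "word_value 2 w = real (binary_number w) / 2 ^ length w"
proof (induction w)
  case Nil
  show ?case by (simp add: word_value_def)
next
  case (Cons a w)
  have "word_value 2 (a # w) = real a / 2 + word_value 2 w / 2"
    by (simp add: word_value_def sum.lessThan_Suc_shift sum_divide_distrib field_simps
             del: sum.lessThan_Suc)
  thus ?case
    using Cons by (simp add: field_simps)
qed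

text \<open>
  The integer form of "a window of length $2^{-m}$ contains at most two multiples of $2^{-m}$".
\<close>

lemma card_le_2_if_binary_numbers_close:
  assumes "A \<subseteq> binary_words k"
    and close: "\<And>u v. u \<in> A \<Longrightarrow> v \<in> A \<Longrightarrow> binary_number u \<le> Suc (binary_number v)"
  shows "card A \<le> 2"
proof (cases "A = {}")
  case True
  thus ?thesis by simp
next
  case False
  have fin: "finite A"
    using assms(1) finite_binary_words finite_subset by blast
  define p where "p = Min (binary_number ` A)"
  have "p \<in> binary_number ` A"
    unfolding p_def using fin False by (intro Min_in) auto
  then obtain v where v: "v \<in> A" "p = binary_number v" by auto
  have "binary_number ` A \<subseteq> {p, Suc p}"
  proof
    fix q assume q: "q \<in> binary_number ` A"
    have "p \<le> q" unfolding p_def using fin q by (intro Min_le) auto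
    moreover have "q \<le> Suc p" using close v q by auto
    ultimately show "q \<in> {p, Suc p}" by auto
  qed
  hence "card (binary_number ` A) \<le> card {p, Suc p}"
    by (intro card_mono) auto
  moreover have "card (binary_number ` A) = card A"
    by (intro card_image inj_on_subset[OF inj_on_binary_number assms(1)])
  ultimately show ?thesis by simp
qed

section \<open>Splitting an expansion after a prefix\<close>

lemma expansion_tail_sums:
  assumes "is_expansion x \<beta> e" "\<forall>n<length w. e n = w ! n"
  shows "(\<lambda>n. real (e (n + length w)) / \<beta> ^ Suc (n + length w)) sums (x - word_value \<beta> w)"
proof -
  have "(\<lambda>n. real (e n) / \<beta> ^ Suc n) sums x"
    using assms(1) by (simp add: is_expansion_def)
  hence "(\<lambda>n. real (e (n + length w)) / \<beta> ^ Suc (n + length w)) sums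
         (x - (\<Sum>n<length w. real (e n) / \<beta> ^ Suc n))"
    by (rule sums_split_initial_segment)
  moreover have "(\<Sum>n<length w. real (e n) / \<beta> ^ Suc n) = word_value \<beta> w"
    unfolding word_value_def using assms(2) by (intro sum.cong) auto
  ultimately show ?thesis by simp
qed

lemma geometric_tail_sums:
  fixes \<beta> :: real
  assumes "1 < \<beta>"
  shows "(\<lambda>n. 1 / \<beta> ^ Suc (n + m)) sums (1 / \<beta> ^ m / (\<beta> - 1))"
proof -
  have "(\<lambda>n. (1 / \<beta>) ^ n) sums (1 / (1 - 1 / \<beta>))"
    using assms by (intro geometric_sums) simp
  from sums_mult[OF this, of "1 / \<beta> ^ Suc m"]
  have "(\<lambda>n. 1 / \<beta> ^ Suc m * (1 / \<beta>) ^ n) sums (1 / \<beta> ^ Suc m * (1 / (1 - 1 / \<beta>)))" .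
  moreover have "(\<lambda>n. 1 / \<beta> ^ Suc m * (1 / \<beta>) ^ n) = (\<lambda>n. 1 / \<beta> ^ Suc (n + m))"
    by (rule ext) (simp add: power_add power_divide)
  moreover have "1 / \<beta> ^ Suc m * (1 / (1 - 1 / \<beta>)) = 1 / \<beta> ^ m / (\<beta> - 1)"
    using assms by (simp add: field_simps)
  ultimately show ?thesis by metis
qed

lemma prefix_value_window:
  assumes "1 < \<beta>" "w \<in> expansion_prefixes m x \<beta>"
  shows "0 \<le> x - word_value \<beta> w" "x - word_value \<beta> w \<le> 1 / \<beta> ^ m / (\<beta> - 1)"
proof -
  obtain e where e: "is_expansion x \<beta> e" "\<forall>n<m. e n = w ! n" and len: "length w = m"
    using assms(2) by (auto simp: expansion_prefixes_def)
  have tail: "(\<lambda>n. real (e (n + m)) / \<beta> ^ Suc (n + m)) sums (x - word_value \<beta> w)"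
    using expansion_tail_sums[of x \<beta> e w] e len by simp
  have digit: "0 \<le> real (e n) \<and> real (e n) \<le> 1" for n
    using e(1) by (auto simp: is_expansion_def dest: spec[of _ n])
  show "0 \<le> x - word_value \<beta> w"
    using sums_le[OF _ sums_zero tail] assms(1) by simp
  show "x - word_value \<beta> w \<le> 1 / \<beta> ^ m / (\<beta> - 1)"
    by (rule sums_le[OF _ tail geometric_tail_sums[OF assms(1)]])
       (use assms(1) digit in \<open>auto intro!: divide_right_mono\<close>)
qed

text \<open>
  The number $\beta^m (x - v)$, with \<open>v\<close> the value of the prefix, is what the remaining digits
  expand.
\<close>

lemma expansion_prefixes_append:
  assumes "1 < \<beta>"
  shows "expansion_prefixes (m + k) x \<beta> \<subseteq>
         (\<Union>u\<in>expansion_prefixes m x \<beta>.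
            (\<lambda>v. u @ v) ` expansion_prefixes k (\<beta> ^ m * (x - word_value \<beta> u)) \<beta>)"
proof
  fix w assume "w \<in> expansion_prefixes (m + k) x \<beta>"
  then obtain e where e: "is_expansion x \<beta> e" "\<forall>n<m + k. e n = w ! n"
    and w: "length w = m + k" "set w \<subseteq> {0, 1}"
    by (auto simp: expansion_prefixes_def)
  define u v where "u = take m w" and "v = drop m w"
  have len: "length u = m" "length v = k"
    using w by (auto simp: u_def v_def)
  have digits: "set u \<subseteq> {0, 1}" "set v \<subseteq> {0, 1}"
    using w(2) set_take_subset[of m w] set_drop_subset[of m w] by (auto simp: u_def v_def)
  have eu: "\<forall>n<m. e n = u ! n"
    using e(2) by (auto simp: u_def)
  have ev: "\<forall>n<k. e (n + m) = v ! n"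
    using e(2) w(1) by (auto simp: v_def add.commute)
  have u: "u \<in> expansion_prefixes m x \<beta>"
    using len digits eu e(1) by (auto simp: expansion_prefixes_def)
  have "(\<lambda>n. real (e (n + m)) / \<beta> ^ Suc (n + m)) sums (x - word_value \<beta> u)"
    using expansion_tail_sums[of x \<beta> e u] e(1) eu len by simp
  from sums_mult[OF this, of "\<beta> ^ m"]
  have "(\<lambda>n. real (e (n + m)) / \<beta> ^ Suc n) sums (\<beta> ^ m * (x - word_value \<beta> u))"
    using assms by (simp add: power_add)
  hence "is_expansion (\<beta> ^ m * (x - word_value \<beta> u)) \<beta> (\<lambda>n. e (n + m))"
    using e(1) by (simp add: is_expansion_def)
  hence v: "v \<in> expansion_prefixes k (\<beta> ^ m * (x - word_value \<beta> u)) \<beta>"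
    using len digits ev unfolding expansion_prefixes_def by blast
  have "w = u @ v" by (simp add: u_def v_def)
  thus "w \<in> (\<Union>u\<in>expansion_prefixes m x \<beta>.
            (\<lambda>v. u @ v) ` expansion_prefixes k (\<beta> ^ m * (x - word_value \<beta> u)) \<beta>)"
    using u v by blast
qed

section \<open>At most two prefixes of a given length near base two\<close>

text \<open>
  Words whose binary numbers differ by at least two have values at distance at least
  $2 \cdot 2^{-m}$ in base \<open>2\<close>, twice the length of the window there; the strict inequality between
  distance and window length then persists in nearby bases.
\<close>

lemma eventually_word_values_separated:
  assumes "length u = m" "length v = m" "Suc (binary_number v) < binary_number u"
  shows "eventually (\<lambda>\<beta>. 1 / \<beta> ^ m / (\<beta> - 1) < word_value \<beta> u - word_value \<beta> v)
           (at 2 within S)"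
proof -
  let ?g = "\<lambda>\<beta>. word_value \<beta> u - word_value \<beta> v - 1 / \<beta> ^ m / (\<beta> - 1)"
  have "(?g \<longlongrightarrow> ?g 2) (at 2 within S)"
    unfolding word_value_def by (intro tendsto_intros) auto
  moreover have "?g 2 > 0"
  proof -
    have "1 < real (binary_number u) - real (binary_number v)"
      using assms(3) by linarith
    moreover have "?g 2 = (real (binary_number u) - real (binary_number v) - 1) / 2 ^ m"
      using assms(1,2) by (simp add: word_value_2 diff_divide_distrib)
    ultimately show ?thesis by simp
  qed
  ultimately have "eventually (\<lambda>\<beta>. 0 < ?g \<beta>) (at 2 within S)"
    by (rule order_tendstoD)
  thus ?thesis by eventually_elim simp
qed

lemma eventually_num_prefixes_le_2:
  "eventually (\<lambda>\<beta>. \<forall>x. num_prefixes m x \<beta> \<le> 2) (at 2 within {1<..<2})"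
proof -
  define P where
    "P = {(u, v) \<in> binary_words m \<times> binary_words m. Suc (binary_number v) < binary_number u}"
  have "finite P"
    unfolding P_def
    by (rule finite_subset[of _ "binary_words m \<times> binary_words m"])
       (auto simp: finite_binary_words)
  moreover have "\<forall>p\<in>P. eventually (\<lambda>\<beta>. 1 / \<beta> ^ m / (\<beta> - 1) <
                   word_value \<beta> (fst p) - word_value \<beta> (snd p)) (at 2 within {1<..<2})"
    unfolding P_def binary_words_def
    by (intro ballI eventually_word_values_separated) auto
  ultimately have "eventually (\<lambda>\<beta>. \<forall>p\<in>P. 1 / \<beta> ^ m / (\<beta> - 1) <
                   word_value \<beta> (fst p) - word_value \<beta> (snd p)) (at 2 within {1<..<2})"
    by (rule eventually_ball_finite)
  moreover have "eventually (\<lambda>\<beta>. \<beta> \<in> {1<..<2}) (at (2::real) within {1<..<2})"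
    by (simp add: eventually_at_filter)
  ultimately show ?thesis
  proof eventually_elim
    case (elim \<beta>)
    show ?case
    proof
      fix x
      show "num_prefixes m x \<beta> \<le> 2"
        unfolding num_prefixes_def
      proof (rule card_le_2_if_binary_numbers_close[OF expansion_prefixes_subset])
        fix u v assume u: "u \<in> expansion_prefixes m x \<beta>" and v: "v \<in> expansion_prefixes m x \<beta>"
        show "binary_number u \<le> Suc (binary_number v)"
        proof (rule ccontr)
          assume "\<not> ?thesis"
          hence "(u, v) \<in> P"
            using u v expansion_prefixes_subset by (auto simp: P_def)
          hence "1 / \<beta> ^ m / (\<beta> - 1) < word_value \<beta> u - word_value \<beta> v"
            using elim(1) by fastforce
          thus False
            using prefix_value_window[of \<beta> u m x] prefix_value_window[of \<beta> v m x] u v elim(2)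
            by simp
        qed
      qed
    qed
  qed
qed

section \<open>Growth rate of the number of prefixes\<close>

text \<open>
  The hypothesis is required at every real number, since the induction moves from \<open>x\<close> to the
  numbers expanded by the remaining digits.
\<close>

lemma num_prefixes_le_power:
  assumes "1 < \<beta>" and two: "\<And>x. num_prefixes m x \<beta> \<le> 2"
  shows "num_prefixes (j * m + r) x \<beta> \<le> 2 ^ (j + r)"
proof (induction j arbitrary: x)
  case 0
  have "card (expansion_prefixes r x \<beta>) \<le> card (binary_words r)"
    by (intro card_mono finite_binary_words expansion_prefixes_subset)
  thus ?case by (simp add: num_prefixes_def card_binary_words)
next
  case (Suc j)
  let ?k = "j * m + r"
  let ?E = "\<lambda>u. expansion_prefixes ?k (\<beta> ^ m * (x - word_value \<beta> u)) \<beta>"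
  have "num_prefixes (Suc j * m + r) x \<beta> = card (expansion_prefixes (m + ?k) x \<beta>)"
    by (simp add: num_prefixes_def add.assoc)
  also have "\<dots> \<le> card (\<Union>u\<in>expansion_prefixes m x \<beta>. (\<lambda>v. u @ v) ` ?E u)"
    by (intro card_mono expansion_prefixes_append assms(1))
       (auto simp: finite_expansion_prefixes)
  also have "\<dots> \<le> (\<Sum>u\<in>expansion_prefixes m x \<beta>. card ((\<lambda>v. u @ v) ` ?E u))"
    by (intro card_UN_le finite_expansion_prefixes)
  also have "\<dots> \<le> (\<Sum>u\<in>expansion_prefixes m x \<beta>. 2 ^ (j + r))"
  proof (rule sum_mono)
    fix u
    have "card ((\<lambda>v. u @ v) ` ?E u) \<le> card (?E u)"
      by (intro card_image_le finite_expansion_prefixes)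
    also have "\<dots> \<le> 2 ^ (j + r)"
      using Suc.IH by (simp add: num_prefixes_def)
    finally show "card ((\<lambda>v. u @ v) ` ?E u) \<le> 2 ^ (j + r)" .
  qed
  also have "\<dots> = num_prefixes m x \<beta> * 2 ^ (j + r)"
    by (simp add: num_prefixes_def)
  also have "\<dots> \<le> 2 * 2 ^ (j + r)"
    using two by (intro mult_right_mono) auto
  finally show ?case by simp
qed

lemma log2_num_prefixes_le:
  assumes "1 < \<beta>" "\<And>x. num_prefixes m x \<beta> \<le> 2" "0 < m"
  shows "log 2 (real (num_prefixes k x \<beta>)) \<le> real k / real m + real m"
proof (cases "num_prefixes k x \<beta> = 0")
  case True
  thus ?thesis by (simp add: log_def)
next
  case False
  have "num_prefixes k x \<beta> \<le> 2 ^ (k div m + k mod m)"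
    using num_prefixes_le_power[OF assms(1,2), where j = "k div m" and r = "k mod m"] by simp
  hence "real (num_prefixes k x \<beta>) \<le> 2 ^ (k div m + k mod m)"
    using of_nat_mono by fastforce
  hence "log 2 (real (num_prefixes k x \<beta>)) \<le> log 2 (2 ^ (k div m + k mod m))"
    using False by (subst log_le_cancel_iff) auto
  also have "\<dots> = real (k div m) + real (k mod m)"
    by (simp add: log_nat_power)
  also have "\<dots> \<le> real k / real m + real m"
    using assms(3) by (intro add_mono) (auto simp: of_nat_div_le_of_nat less_imp_le)
  finally show ?thesis .
qed

lemma growth_rate_le:
  assumes "1 < \<beta>" "\<And>x. num_prefixes m x \<beta> \<le> 2" "0 < m"
  shows "growth_rate x \<beta> \<le> ereal (1 / real m)"
proof -
  have "growth_rate x \<beta> \<le> limsup (\<lambda>k. ereal (1 / real m + real m / real k))"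
    unfolding growth_rate_def
  proof (rule Limsup_mono)
    show "\<forall>\<^sub>F k in sequentially. ereal (log 2 (real (num_prefixes k x \<beta>)) / real k)
            \<le> ereal (1 / real m + real m / real k)"
      using eventually_gt_at_top[of 0]
    proof eventually_elim
      case (elim k)
      have "log 2 (real (num_prefixes k x \<beta>)) / real k \<le> (real k / real m + real m) / real k"
        using log2_num_prefixes_le[OF assms] by (intro divide_right_mono) auto
      also have "\<dots> = 1 / real m + real m / real k"
        using elim by (simp add: add_divide_distrib)
      finally show ?case by simp
    qed
  qed
  also have "\<dots> = ereal (1 / real m)"
  proof (rule lim_imp_Limsup)
    have "(\<lambda>k. 1 / real m + real m / real k) \<longlonglongrightarrow> 1 / real m + 0"
      by (intro tendsto_add tendsto_const lim_const_over_n)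
    thus "((\<lambda>k. ereal (1 / real m + real m / real k)) \<longlonglongrightarrow> ereal (1 / real m))"
      by simp
  qed simp
  finally show ?thesis .
qed

text \<open>
  The logarithm of a natural number is nonnegative even at zero, by the convention
  $\log_2 0 = 0$.
\<close>

lemma growth_rate_nonneg: "0 \<le> growth_rate x \<beta>"
proof -
  have "0 \<le> log 2 (real n)" for n :: nat
    by (cases "n = 0") (auto simp: log_def)
  hence "limsup (\<lambda>k::nat. 0 :: ereal) \<le> growth_rate x \<beta>"
    unfolding growth_rate_def by (intro Limsup_mono always_eventually) simp
  thus ?thesis by (simp add: Limsup_const)
qed

theorem theorem4p1:
  shows "((\<lambda>\<beta>::real. SUP x\<in>{0<..<1 / (\<beta> - 1)}. growth_rate x \<beta>) \<longlongrightarrow> (0::ereal))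
           (at 2 within {1<..<2})"
proof (rule order_tendstoI)
  have in_range: "eventually (\<lambda>\<beta>. \<beta> \<in> {1<..<2}) (at (2::real) within {1<..<2})"
    by (simp add: eventually_at_filter)
  {
    fix a :: ereal assume a: "a < 0"
    show "eventually (\<lambda>\<beta>. a < (SUP x\<in>{0<..<1 / (\<beta> - 1)}. growth_rate x \<beta>))
            (at 2 within {1<..<2})"
      using in_range
    proof eventually_elim
      case (elim \<beta>)
      then obtain x where "x \<in> {0<..<1 / (\<beta> - 1)}"
        using dense[of 0 "1 / (\<beta> - 1)"] by auto
      hence "0 \<le> (SUP x\<in>{0<..<1 / (\<beta> - 1)}. growth_rate x \<beta>)"
        using growth_rate_nonneg by (rule SUP_upper2)
      thus ?case using a by simp
    qed
  }
  {
    fix a :: ereal assume a: "0 < a"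
    obtain c where c: "0 < c" "ereal c < a"
      using ereal_dense2[OF a] by auto
    obtain m :: nat where m: "0 < m" "1 / real m < c"
      using nat_approx_posE[OF c(1)] by (metis zero_less_Suc)
    show "eventually (\<lambda>\<beta>. (SUP x\<in>{0<..<1 / (\<beta> - 1)}. growth_rate x \<beta>) < a)
            (at 2 within {1<..<2})"
      using in_range eventually_num_prefixes_le_2[of m]
    proof eventually_elim
      case (elim \<beta>)
      have "(SUP x\<in>{0<..<1 / (\<beta> - 1)}. growth_rate x \<beta>) \<le> ereal (1 / real m)"
        using elim m(1) by (intro SUP_least growth_rate_le) auto
      also have "\<dots> < ereal c" using m(2) by simp
      finally show ?case using c(2) by (rule less_trans)
    qed
  }
qed

end
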